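(* Let $(M,d)$ be a uniformly discrete bounded (pointed) metric space. Let $x_1,\ldots,x_n,y\in M$ with $x_i\neq y$ for all $i$, and let $\lambda_1,\ldots,\lambda_n$ be positive real numbers with $\sum_{i=1}^n\lambda_i=1$. Define $\varphi:=\sum_{i=1}^n\lambda_i\frac{\delta_{x_i}-\delta_y}{d(x_i,y)}\in\mathcal F(M)$. The following are equivalent: (1) $\varphi$ is a point of Fréchet differentiability of $\mathcal F(M)$. (2) For every $z\in M$ there exists $i\in\{1,\ldots,n\}$ such that $d(x_i,y)=d(x_i,z)+d(z,y)$. (3) $\varphi$ is a point of Gâteaux differentiability of $\mathcal F(M)$.
   Context: $M$ is uniformly discrete if $\inf_{x\neq y}d(x,y)>0$. For a metric space $M$ with a distinguished point $0$, $\mathrm{Lip}_0(M)$ is the Banach space of all real Lipschitz functions on $M$ vanishing at $0$, with norm $\|f\|=\sup\{|f(x)-f(y)|/d(x,y): x\neq y\}$. For $m\in M$ let $\delta_m\in \mathrm{Lip}_0(M)^*$ be $\delta_m(f)=f(m)$. The Lipschitz-free space is $\mathcal F(M)=\overline{\mathrm{span}}\{\delta_m:m\in M\}\subseteq \mathrm{Lip}_0(M)^*$ with the dual norm; it satisfies $\mathcal F(M)^*=\mathrm{Lip}_0(M)$. A point $x$ of a Banach space $X$ is a point of Gâteaux differentiability of $X$ if the norm of $X$ is Gâteaux differentiable at $x$, equivalently the limit $\lim_{t\to0}\frac{\|x+th\|-\|x\|}{t}$ exists for every $h\in X$; it is a point of Fréchet differentiability of $X$ if moreover this limit is uniform for $h\in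 S_X$ (the unit sphere). *)

theory Defs
  imports "HOL-Analysis.Analysis"
begin

class pointed_metric_space = metric_space +
  fixes base_point :: 'a

typedef (overloaded) 'a lip0 =
  "{f :: 'a::pointed_metric_space \<Rightarrow> real. (\<exists>C. C-lipschitz_on UNIV f) \<and> f base_point = 0}"
  morphisms lip0_apply Abs_lip0
proof
  show "(\<lambda>_. 0) \<in> {f :: 'a \<Rightarrow> real. (\<exists>C. C-lipschitz_on UNIV f) \<and> f base_point = 0}"
    by (auto intro!: exI[of _ 0] lipschitz_onI)
qed

setup_lifting type_definition_lip0

instantiation lip0 :: (pointed_metric_space) real_vector
begin

lift_definition zero_lip0 :: "'a lip0" is "\<lambda>_. 0"
  by (auto intro!: exI[of _ 0] lipschitz_onI)

lift_definition plus_lip0 :: "'a lip0 \<Rightarrow> 'a lip0 \<Rightarrow> 'a lip0" is "\<lambda>f g x. f x + g x"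
  by (auto intro: lipschitz_on_add)

lift_definition scaleR_lip0 :: "real \<Rightarrow> 'a lip0 \<Rightarrow> 'a lip0" is "\<lambda>r f x. r * f x"
  using lipschitz_on_cmult_real by fastforce

lift_definition uminus_lip0 :: "'a lip0 \<Rightarrow> 'a lip0" is "\<lambda>f x. - f x"
  by (auto intro: lipschitz_on_minus)

lift_definition minus_lip0 :: "'a lip0 \<Rightarrow> 'a lip0 \<Rightarrow> 'a lip0" is "\<lambda>f g x. f x - g x"
  by (auto intro: lipschitz_on_diff)

instance
  by standard (transfer; auto simp: algebra_simps)+

end

instantiation lip0 :: (pointed_metric_space) real_normed_vector
begin

text \<open>The supremum runs over all pairs. A pair with \<open>x = y\<close> contributes \<open>0 / 0 = 0\<close>, which only
  matters for a one-point space, where the supremum over \<open>x \<noteq> y\<close> would range over the empty set.\<close>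
lift_definition norm_lip0 :: "'a lip0 \<Rightarrow> real"
  is "\<lambda>f. SUP (x, y). \<bar>f x - f y\<bar> / dist x y" .

definition dist_lip0 :: "'a lip0 \<Rightarrow> 'a lip0 \<Rightarrow> real"
  where "dist_lip0 f g = norm (f - g)"

definition sgn_lip0 :: "'a lip0 \<Rightarrow> 'a lip0"
  where "sgn_lip0 f = f /\<^sub>R norm f"

definition uniformity_lip0 :: "('a lip0 \<times> 'a lip0) filter"
  where "uniformity_lip0 = (INF e\<in>{0<..}. principal {(f, g). dist f g < e})"

definition open_lip0 :: "'a lip0 set \<Rightarrow> bool"
  where "open_lip0 S = (\<forall>f\<in>S. \<forall>\<^sub>F (f', g) in uniformity. f' = f \<longrightarrow> g \<in> S)"

lemma lip0_bdd_above: "bdd_above (range (\<lambda>(x, y). \<bar>lip0_apply f x - lip0_apply f y\<bar> / dist x y))"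
proof -
  obtain C where C: "C-lipschitz_on UNIV (lip0_apply f)"
    using lip0_apply[of f] by blast
  have "\<bar>lip0_apply f x - lip0_apply f y\<bar> / dist x y \<le> C" for x y
    using lipschitz_onD[OF C, of x y] lipschitz_on_nonneg[OF C]
    by (cases "x = y") (auto simp: dist_real_def divide_le_eq)
  then show ?thesis by (auto intro!: bdd_aboveI[of _ C])
qed

lemma lip0_quotient_le_norm: "\<bar>lip0_apply f x - lip0_apply f y\<bar> / dist x y \<le> norm f"
  using cSUP_upper[OF UNIV_I lip0_bdd_above, of f "(x, y)"]
  by (simp add: norm_lip0.rep_eq)

lemma lip0_diff_le_norm: "\<bar>lip0_apply f x - lip0_apply f y\<bar> \<le> norm f * dist x y"
  using lip0_quotient_le_norm[of f x y] by (cases "x = y") (auto simp: divide_le_eq)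

lemma lip0_norm_nonneg: "0 \<le> norm (f :: 'a lip0)"
  using lip0_quotient_le_norm[of f base_point base_point] by simp

lemma lip0_norm_leI:
  assumes "\<And>x y. \<bar>lip0_apply f x - lip0_apply f y\<bar> \<le> C * dist x y" "0 \<le> C"
  shows "norm f \<le> C"
  unfolding norm_lip0.rep_eq
proof (rule cSUP_least)
  fix p :: "'a \<times> 'a"
  show "(case p of (x, y) \<Rightarrow> \<bar>lip0_apply f x - lip0_apply f y\<bar> / dist x y) \<le> C"
    using assms by (cases p; cases "fst p = snd p") (auto simp: divide_le_eq)
qed simp

lemma lip0_norm_scaleR_le: "norm (a *\<^sub>R f) \<le> \<bar>a\<bar> * norm (f :: 'a lip0)"
proof (rule lip0_norm_leI)
  fix x y
  have "\<bar>lip0_apply (a *\<^sub>R f) x - lip0_apply (a *\<^sub>R f) y\<bar>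
      = \<bar>a\<bar> * \<bar>lip0_apply f x - lip0_apply f y\<bar>"
    by (simp add: scaleR_lip0.rep_eq abs_mult[symmetric] algebra_simps)
  also have "\<dots> \<le> \<bar>a\<bar> * (norm f * dist x y)"
    by (intro mult_left_mono lip0_diff_le_norm) simp
  finally show "\<bar>lip0_apply (a *\<^sub>R f) x - lip0_apply (a *\<^sub>R f) y\<bar> \<le> \<bar>a\<bar> * norm f * dist x y"
    by (simp add: mult.assoc)
qed (simp add: lip0_norm_nonneg)

instance
proof
  fix f g :: "'a lip0" and a :: real
  show "dist f g = norm (f - g)" by (rule dist_lip0_def)
  show "sgn f = f /\<^sub>R norm f" by (rule sgn_lip0_def)
  show "uniformity = (INF e\<in>{0<..}. principal {(f :: 'a lip0, g). dist f g < e})"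
    by (rule uniformity_lip0_def)
  show "open S = (\<forall>f\<in>S. \<forall>\<^sub>F (f', g) in uniformity. f' = f \<longrightarrow> g \<in> S)" for S :: "'a lip0 set"
    by (rule open_lip0_def)
  show "norm f = 0 \<longleftrightarrow> f = 0"
  proof
    assume "norm f = 0"
    then have "lip0_apply f x = 0" for x
      using lip0_diff_le_norm[of f x base_point] lip0_apply[of f] by simp
    then show "f = 0"
      by (simp add: lip0_apply_inject[symmetric] zero_lip0.rep_eq fun_eq_iff)
  next
    assume "f = 0"
    then have "norm f \<le> 0"
      by (intro lip0_norm_leI) (auto simp: zero_lip0.rep_eq)
    then show "norm f = 0" using lip0_norm_nonneg[of f] by simp
  qed
  show "norm (f + g) \<le> norm f + norm g"
  proof (rule lip0_norm_leI)
    fix x y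
    show "\<bar>lip0_apply (f + g) x - lip0_apply (f + g) y\<bar> \<le> (norm f + norm g) * dist x y"
      using lip0_diff_le_norm[of f x y] lip0_diff_le_norm[of g x y]
      by (simp add: plus_lip0.rep_eq distrib_right)
  qed (simp add: lip0_norm_nonneg)
  show "norm (a *\<^sub>R f) = \<bar>a\<bar> * norm f"
  proof (cases "a = 0")
    case True
    then show ?thesis
      using lip0_norm_scaleR_le[of a f] lip0_norm_nonneg[of "a *\<^sub>R f"] by simp
  next
    case False
    have "\<bar>a\<bar> * norm f \<le> norm (a *\<^sub>R f)"
      using lip0_norm_scaleR_le[of "inverse a" "a *\<^sub>R f"] False by (simp add: field_simps)
    then show ?thesis using lip0_norm_scaleR_le[of a f] by simp
  qed
qed

end

lift_definition lip_delta :: "'a::pointed_metric_space \<Rightarrow> 'a lip0 \<Rightarrow>\<^sub>L real"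
  is "\<lambda>m f. lip0_apply f m"
proof -
  fix m :: 'a
  show "bounded_linear (\<lambda>f. lip0_apply f m)"
  proof (rule bounded_linear_intro)
    show "norm (lip0_apply f m) \<le> norm f * dist m base_point" for f
      using lip0_diff_le_norm[of f m base_point] lip0_apply[of f] by simp
  qed (auto simp: plus_lip0.rep_eq scaleR_lip0.rep_eq)
qed

definition lipschitz_free :: "('a::pointed_metric_space lip0 \<Rightarrow>\<^sub>L real) set"
  where "lipschitz_free = closure (span (range lip_delta))"

text \<open>In the next two definitions \<open>X\<close> is a closed linear subspace of the ambient normed space, regarded
  as a Banach space in its own right: only directions \<open>h \<in> X\<close> are considered.\<close>
definition gateaux_point :: "'b::real_normed_vector set \<Rightarrow> 'b \<Rightarrow> bool"
  where "gateaux_point X x \<longleftrightarrow> x \<in> X \<and>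
    (\<forall>h\<in>X. \<exists>l. ((\<lambda>t. (norm (x + t *\<^sub>R h) - norm x) / t) \<longlongrightarrow> l) (at 0))"

definition frechet_point :: "'b::real_normed_vector set \<Rightarrow> 'b \<Rightarrow> bool"
  where "frechet_point X x \<longleftrightarrow> gateaux_point X x \<and>
    (\<exists>L. uniform_limit {h \<in> X. norm h = 1} (\<lambda>t h. (norm (x + t *\<^sub>R h) - norm x) / t) L (at 0))"

end

theory Submission
  imports Defs
begin

text \<open>A norm-one function \<open>f\<close> satisfies \<open>\<phi> f = 1 = norm \<phi>\<close> iff \<open>f (x i) - f y = dist (x i) y\<close> for all
  \<open>i\<close>; in particular \<open>dist _ y\<close>, normalised at the base point, norms \<open>\<phi>\<close>. If (2) holds, then a
  function \<open>f\<close> in the unit ball is squeezed along the segments through \<open>z\<close>, and uniform discreteness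
  turns this into \<open>norm (f - dist _ y) \<le> K * (1 - \<phi> f)\<close>. This bound is linear in the defect \<open>1 - \<phi> f\<close>, so
  the dual norm is even affine along every line near \<open>\<phi>\<close>. If (2) fails at \<open>z\<close>, then the least
  norming function \<open>p \<mapsto> max (dist (x i) y - dist (x i) p)\<close> differs from \<open>dist _ y\<close> at \<open>z\<close>, which
  contradicts differentiability in the direction \<open>\<delta>\<^sub>z - \<delta>\<^sub>y\<close>.\<close>

section \<open>Dual norms, norming elements and differentiability\<close>

lemma blinfun_apply_le_norm:
  fixes A :: "'b::real_normed_vector \<Rightarrow>\<^sub>L real"
  assumes "norm f \<le> 1"
  shows "blinfun_apply A f \<le> norm A"
proof -
  have "blinfun_apply A f \<le> norm A * norm f"
    using norm_blinfun[of A f] by simp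
  also have "\<dots> \<le> norm A"
    using assms by (simp add: mult_left_le)
  finally show ?thesis .
qed

text \<open>The unit ball is symmetric: testing both \<open>f\<close> and \<open>- f\<close>, scaled
  to norm one, turns the one-sided bound into a bound on the absolute value.\<close>

lemma norm_blinfun_leI_unit_ball:
  fixes A :: "'b::real_normed_vector \<Rightarrow>\<^sub>L real"
  assumes le: "\<And>f. norm f \<le> 1 \<Longrightarrow> blinfun_apply A f \<le> C"
  shows "norm A \<le> C"
proof (rule norm_blinfun_bound)
  show "0 \<le> C"
    using le[of 0] by simp
next
  fix f
  show "norm (blinfun_apply A f) \<le> C * norm f"
  proof (cases "f = 0")
    case False
    then have "\<bar>blinfun_apply A f\<bar> / norm f \<le> C"
      using le[of "f /\<^sub>R norm f"] le[of "- f /\<^sub>R norm f"]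
      by (simp add: blinfun.scaleR_right blinfun.minus_right abs_if divide_inverse mult.commute)
    with False show ?thesis
      by (simp add: divide_le_eq)
  qed simp
qed

text \<open>Every norming \<open>k\<close> gives the affine minorant \<open>norm A + t * h k\<close>
  of \<open>norm (A + t *\<^sub>R h)\<close>, with equality at \<open>t = 0\<close>. Comparing
  slopes from the right and from the left forces \<open>h k\<close> to be the derivative, whatever
  \<open>k\<close> is.\<close>

lemma gateaux_point_norming_eq:
  fixes A :: "'b::real_normed_vector \<Rightarrow>\<^sub>L real"
  assumes A: "gateaux_point X A" and h: "h \<in> X"
    and f: "norm f \<le> 1" "blinfun_apply A f = norm A"
    and g: "norm g \<le> 1" "blinfun_apply A g = norm A"
  shows "blinfun_apply h f = blinfun_apply h g"
proof -
  let ?q = "\<lambda>t. (norm (A + t *\<^sub>R h) - norm A) / t"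
  obtain l where l: "(?q \<longlongrightarrow> l) (at 0)"
    using A h unfolding gateaux_point_def by blast
  have "blinfun_apply h k = l" if k: "norm k \<le> 1" "blinfun_apply A k = norm A" for k
  proof -
    have ge: "t * blinfun_apply h k \<le> norm (A + t *\<^sub>R h) - norm A" for t
      using blinfun_apply_le_norm[OF k(1), of "A + t *\<^sub>R h"] k(2)
      by (simp add: blinfun.add_left blinfun.scaleR_left)
    have "blinfun_apply h k \<le> l"
    proof (rule tendsto_lowerbound)
      show "(?q \<longlongrightarrow> l) (at_right 0)"
        using l by (simp add: filterlim_at_split)
      show "\<forall>\<^sub>F t in at_right 0. blinfun_apply h k \<le> ?q t"
        using eventually_at_right_less
      proof (rule eventually_mono)
        show "blinfun_apply h k \<le> ?q t" if "0 < t" for t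
          using ge[of t] that by (simp add: pos_le_divide_eq mult.commute)
      qed
    qed simp
    moreover have "l \<le> blinfun_apply h k"
    proof (rule tendsto_upperbound)
      show "(?q \<longlongrightarrow> l) (at_left 0)"
        using l by (simp add: filterlim_at_split)
      have "\<forall>\<^sub>F t in at_left 0. t < (0::real)"
        by (simp add: eventually_at_filter)
      then show "\<forall>\<^sub>F t in at_left 0. ?q t \<le> blinfun_apply h k"
      proof (rule eventually_mono)
        show "?q t \<le> blinfun_apply h k" if "t < 0" for t
          using ge[of t] that by (simp add: neg_divide_le_eq mult.commute)
      qed
    qed simp
    ultimately show ?thesis by simp
  qed
  then show ?thesis using f g by simp
qed

text \<open>Moving from \<open>f0\<close> to \<open>f\<close> costs \<open>A\<close> at least
  \<open>norm (f - f0) / K\<close>, while the perturbation \<open>t *\<^sub>R h\<close> gains at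
  most \<open>\<bar>t\<bar> * norm h * norm (f - f0)\<close>. For small \<open>t\<close> the cost
  wins, so \<open>f0\<close> still norms \<open>A + t *\<^sub>R h\<close> and the difference
  quotient is constant.\<close>

lemma frechet_point_if_sharp_norming:
  fixes A :: "'b::real_normed_vector \<Rightarrow>\<^sub>L real"
  assumes "A \<in> X" and f0: "norm f0 \<le> 1" "blinfun_apply A f0 = norm A"
    and sharp: "\<And>f. norm f \<le> 1 \<Longrightarrow> norm (f - f0) \<le> K * (norm A - blinfun_apply A f)"
    and K: "0 < K"
  shows "frechet_point X A"
proof -
  have quot: "(norm (A + t *\<^sub>R h) - norm A) / t = blinfun_apply h f0"
    if t: "\<bar>t\<bar> * norm h * K \<le> 1" "t \<noteq> 0" for t h
  proof -
    have "norm (A + t *\<^sub>R h) \<le> norm A + t * blinfun_apply h f0"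
    proof (rule norm_blinfun_leI_unit_ball)
      fix f :: 'b assume f: "norm f \<le> 1"
      let ?d = "norm A - blinfun_apply A f"
      have d: "0 \<le> ?d"
        using blinfun_apply_le_norm[OF f, of A] by simp
      have "t * (blinfun_apply h f - blinfun_apply h f0) \<le> \<bar>t\<bar> * \<bar>blinfun_apply h (f - f0)\<bar>"
        by (metis abs_ge_self abs_mult blinfun.diff_right)
      also have "\<dots> \<le> \<bar>t\<bar> * (norm h * (K * ?d))"
        using norm_blinfun[of h "f - f0"] mult_left_mono[OF sharp[OF f] norm_ge_zero[of h]]
        by (intro mult_left_mono) auto
      also have "\<dots> = (\<bar>t\<bar> * norm h * K) * ?d"
        by (simp add: mult.assoc)
      also have "\<dots> \<le> 1 * ?d"
        using t(1) d by (rule mult_right_mono)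
      finally show "blinfun_apply (A + t *\<^sub>R h) f \<le> norm A + t * blinfun_apply h f0"
        by (simp add: blinfun.add_left blinfun.scaleR_left algebra_simps)
    qed
    moreover have "norm A + t * blinfun_apply h f0 \<le> norm (A + t *\<^sub>R h)"
      using blinfun_apply_le_norm[OF f0(1), of "A + t *\<^sub>R h"] f0(2)
      by (simp add: blinfun.add_left blinfun.scaleR_left)
    ultimately show ?thesis
      using t(2) by (simp add: field_simps)
  qed
  \<comment> \<open>The threshold on \<open>t\<close> depends on \<open>h\<close> only through its
    norm \<open>c\<close>; taking \<open>c = 1\<close> therefore gives uniformity on the unit
    sphere.\<close>
  have near: "\<forall>\<^sub>F t in at 0. \<bar>t\<bar> * c * K \<le> 1 \<and> t \<noteq> 0" for c :: real
  proof -
    have "((\<lambda>t. \<bar>t\<bar> * c * K) \<longlongrightarrow> \<bar>0\<bar> * c * K) (at 0)"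
      by (intro tendsto_intros)
    then have "\<forall>\<^sub>F t in at 0. \<bar>t\<bar> * c * K < 1"
      by (rule order_tendstoD) simp
    then show ?thesis
      using eventually_neq_at_within[of 0 0 UNIV] by eventually_elim simp
  qed
  have "((\<lambda>t. (norm (A + t *\<^sub>R h) - norm A) / t) \<longlongrightarrow> blinfun_apply h f0) (at 0)" for h
    by (rule tendsto_eventually) (use near[of "norm h"] in eventually_elim, simp add: quot)
  then have "gateaux_point X A"
    using \<open>A \<in> X\<close> unfolding gateaux_point_def by blast
  moreover have "uniform_limit {h \<in> X. norm h = 1}
      (\<lambda>t h. (norm (A + t *\<^sub>R h) - norm A) / t) (\<lambda>h. blinfun_apply h f0) (at 0)"
  proof (rule uniform_limitI)
    fix e :: real assume "0 < e"
    show "\<forall>\<^sub>F t in at 0. \<forall>h\<in>{h \<in> X. norm h = 1}.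
        dist ((norm (A + t *\<^sub>R h) - norm A) / t) (blinfun_apply h f0) < e"
      using near[of 1] by eventually_elim (use \<open>0 < e\<close> in \<open>simp add: quot\<close>)
  qed
  ultimately show ?thesis
    unfolding frechet_point_def by blast
qed

section \<open>Lipschitz functions of slope at most one, and members of the free space\<close>

lemma lip0_normalise:
  fixes f :: "'a::pointed_metric_space \<Rightarrow> real"
  assumes "\<And>p q. f p - f q \<le> dist p q"
  obtains F :: "'a lip0" where "norm F \<le> 1" "\<And>p. lip0_apply F p = f p - f base_point"
proof -
  \<comment> \<open>Subtracting the value at the base point changes no difference
    \<open>f p - f q\<close>, and \<phi> sees only differences.\<close>
  let ?f = "\<lambda>p. f p - f base_point"
  have le: "\<bar>?f p - ?f q\<bar> \<le> 1 * dist p q" for p q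
    using assms[of p q] assms[of q p] by (simp add: dist_commute abs_le_iff)
  then have "1-lipschitz_on UNIV ?f"
    by (intro lipschitz_onI) (simp_all add: dist_real_def)
  then have F: "lip0_apply (Abs_lip0 ?f) = ?f"
    by (subst Abs_lip0_inverse) auto
  have "norm (Abs_lip0 ?f) \<le> 1"
    using le by (intro lip0_norm_leI) (simp_all add: F)
  then show thesis
    using that F by simp
qed

lemma lip0_unit_ball_diff_le:
  assumes "norm f \<le> 1"
  shows "lip0_apply f p - lip0_apply f q \<le> dist p q"
proof -
  have "lip0_apply f p - lip0_apply f q \<le> norm f * dist p q"
    using lip0_diff_le_norm[of f p q] by simp
  also have "\<dots> \<le> 1 * dist p q"
    using assms by (intro mult_right_mono) auto
  finally show ?thesis by simp
qed

lemma lip_delta_diff_in_lipschitz_free: "lip_delta p - lip_delta q \<in> lipschitz_free"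
  unfolding lipschitz_free_def
  by (intro subsetD[OF closure_subset] span_diff span_base) auto

lemma sum_molecules_in_lipschitz_free:
  "(\<Sum>i\<in>I. w i *\<^sub>R ((lip_delta (x i) - lip_delta y) /\<^sub>R dist (x i) y)) \<in> lipschitz_free"
  unfolding lipschitz_free_def
  by (intro subsetD[OF closure_subset] span_sum span_scale span_diff span_base) auto

section \<open>Convex combinations of molecules with a common endpoint\<close>

theorem theorem4p3:
  fixes n :: nat
    and x :: "nat \<Rightarrow> 'a::pointed_metric_space"
    and y :: 'a
    and w :: "nat \<Rightarrow> real"
    and \<phi> :: "'a lip0 \<Rightarrow>\<^sub>L real"
  assumes "uniform_discrete (UNIV :: 'a set)"
    and "bounded (UNIV :: 'a set)"
    and "\<And>i. i \<in> {1..n} \<Longrightarrow> x i \<noteq> y"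
    and "\<And>i. i \<in> {1..n} \<Longrightarrow> 0 < w i"
    and "(\<Sum>i=1..n. w i) = 1"
    and "\<phi> = (\<Sum>i=1..n. w i *\<^sub>R ((lip_delta (x i) - lip_delta y) /\<^sub>R dist (x i) y))"
  shows "(frechet_point lipschitz_free \<phi> \<longleftrightarrow>
            (\<forall>z. \<exists>i\<in>{1..n}. dist (x i) y = dist (x i) z + dist z y))
       \<and> ((\<forall>z. \<exists>i\<in>{1..n}. dist (x i) y = dist (x i) z + dist z y) \<longleftrightarrow>
            gateaux_point lipschitz_free \<phi>)"
proof -
  let ?seg = "\<forall>z. \<exists>i\<in>{1..n}. dist (x i) y = dist (x i) z + dist z y"
  have pos: "0 < dist (x i) y" if "i \<in> {1..n}" for i
    using assms(3)[OF that] by simp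
  have phi: "blinfun_apply \<phi> f = (\<Sum>i=1..n. w i * ((lip0_apply f (x i) - lip0_apply f y) / dist (x i) y))" for f
    by (simp add: assms(6) blinfun.sum_left blinfun.scaleR_left blinfun.diff_left lip_delta.rep_eq
        divide_inverse mult_ac)
  have norming: "blinfun_apply \<phi> f = 1"
    if "\<And>i. i \<in> {1..n} \<Longrightarrow> lip0_apply f (x i) - lip0_apply f y = dist (x i) y" for f
  proof -
    have "blinfun_apply \<phi> f = (\<Sum>i=1..n. w i)"
      unfolding phi by (rule sum.cong) (use that assms(3) in auto)
    then show ?thesis using assms(5) by simp
  qed
  \<comment> \<open>Since the weights sum to one, the defect splits into one term per molecule. On
    the unit ball these terms are nonnegative, so each is at most the whole defect.\<close>
  have defect: "1 - blinfun_apply \<phi> f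
      = (\<Sum>i=1..n. w i * (1 - (lip0_apply f (x i) - lip0_apply f y) / dist (x i) y))" for f
    unfolding phi using assms(5) by (simp add: right_diff_distrib sum_subtractf)
  have defect_nonneg: "0 \<le> w i * (1 - (lip0_apply f (x i) - lip0_apply f y) / dist (x i) y)"
    if "norm f \<le> 1" "i \<in> {1..n}" for f i
    using lip0_unit_ball_diff_le[OF that(1), of "x i" y] assms(4)[OF that(2)] pos[OF that(2)]
    by (simp add: divide_le_eq)
  obtain f0 :: "'a lip0" where f0: "norm f0 \<le> 1" "\<And>p. lip0_apply f0 p = dist p y - dist base_point y"
    using lip0_normalise[of "\<lambda>p. dist p y"] dist_triangle by (metis diff_le_eq)
  have phi_f0: "blinfun_apply \<phi> f0 = 1"
    by (rule norming) (simp add: f0)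
  have norm_phi: "norm \<phi> = 1"
  proof (rule antisym)
    have "blinfun_apply \<phi> f \<le> 1" if "norm f \<le> 1" for f
    proof -
      have "0 \<le> 1 - blinfun_apply \<phi> f"
        unfolding defect by (intro sum_nonneg defect_nonneg that)
      then show ?thesis by simp
    qed
    then show "norm \<phi> \<le> 1"
      by (rule norm_blinfun_leI_unit_ball)
    show "1 \<le> norm \<phi>"
      using blinfun_apply_le_norm[OF f0(1), of \<phi>] phi_f0 by simp
  qed
  have "frechet_point lipschitz_free \<phi>" if seg: ?seg
  proof -
    obtain \<theta> where \<theta>: "0 < \<theta>" "\<And>p q::'a. p \<noteq> q \<Longrightarrow> \<theta> \<le> dist p q"
      using assms(1) unfolding uniform_discrete_def by (metis UNIV_I not_less)
    \<comment> \<open>Bounding the \<open>i\<close>-th term by the defect produces the factor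
      \<open>dist (x i) y / w i\<close>. The sum dominates all these factors at once, and the
      summand 1 makes positivity immediate.\<close>
    define K where "K = 1 + (\<Sum>i=1..n. dist (x i) y / w i)"
    have K: "0 < K"
      unfolding K_def using assms(4) by (intro add_pos_nonneg sum_nonneg) (auto simp: less_imp_le)
    have sharp: "norm (f - f0) \<le> 2 * K / \<theta> * (norm \<phi> - blinfun_apply \<phi> f)" if f: "norm f \<le> 1" for f
    proof -
      let ?d = "1 - blinfun_apply \<phi> f"
      have d: "0 \<le> ?d"
        using blinfun_apply_le_norm[OF f, of \<phi>] norm_phi by simp
      \<comment> \<open>When \<open>z\<close> lies on a segment from \<open>x i\<close> to
        \<open>y\<close>, the slack of \<open>f\<close> between \<open>x i\<close> and
        \<open>y\<close> is the sum of its slacks on the two pieces. Both are nonnegative, so the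
        slack at \<open>z\<close> is at most the one at \<open>x i\<close>.\<close>
      have close: "0 \<le> dist z y - (lip0_apply f z - lip0_apply f y)
          \<and> dist z y - (lip0_apply f z - lip0_apply f y) \<le> K * ?d" for z
      proof -
        obtain i where i: "i \<in> {1..n}" "dist (x i) y = dist (x i) z + dist z y"
          using seg by blast
        have "w i * (1 - (lip0_apply f (x i) - lip0_apply f y) / dist (x i) y) \<le> ?d"
          unfolding defect by (rule member_le_sum) (use i(1) defect_nonneg[OF f] in auto)
        then have "dist (x i) y - (lip0_apply f (x i) - lip0_apply f y) \<le> dist (x i) y / w i * ?d"
          using assms(4)[OF i(1)] pos[OF i(1)] by (simp add: field_simps)
        also have "\<dots> \<le> K * ?d"
        proof (rule mult_right_mono[OF _ d])
          have "dist (x i) y / w i \<le> (\<Sum>i=1..n. dist (x i) y / w i)"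
            by (rule member_le_sum) (use i(1) assms(4) in \<open>auto simp: less_imp_le\<close>)
          then show "dist (x i) y / w i \<le> K"
            by (simp add: K_def)
        qed
        finally show ?thesis
          using lip0_unit_ball_diff_le[OF f, of "x i" z] lip0_unit_ball_diff_le[OF f, of z y] i(2)
          by linarith
      qed
      have "norm (f - f0) \<le> 2 * K / \<theta> * ?d"
      proof (rule lip0_norm_leI)
        fix p q
        \<comment> \<open>The left side is the distance between two slacks in the interval from 0 to
          \<open>K * ?d\<close>. Distinct points are at least \<theta> apart, so this bound on
          values becomes a bound on slopes.\<close>
        have "\<bar>lip0_apply (f - f0) p - lip0_apply (f - f0) q\<bar> \<le> 2 * K / \<theta> * ?d * \<theta>"
          using close[of p] close[of q] \<theta>(1) by (simp add: minus_lip0.rep_eq f0(2) abs_le_iff)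
        also have "\<dots> \<le> 2 * K / \<theta> * ?d * dist p q" if "p \<noteq> q"
          using \<theta>(1) K d by (intro mult_left_mono \<theta>(2)[OF that]) auto
        finally show "\<bar>lip0_apply (f - f0) p - lip0_apply (f - f0) q\<bar> \<le> 2 * K / \<theta> * ?d * dist p q"
          by (cases "p = q") auto
      qed (use \<theta>(1) K d in auto)
      then show ?thesis by (simp add: norm_phi)
    qed
    show ?thesis
    proof (rule frechet_point_if_sharp_norming[OF _ f0(1) _ sharp])
      show "\<phi> \<in> lipschitz_free"
        unfolding assms(6) by (rule sum_molecules_in_lipschitz_free)
    qed (use phi_f0 norm_phi \<theta>(1) K in auto)
  qed
  moreover have ?seg if gateaux: "gateaux_point lipschitz_free \<phi>"
  proof (rule ccontr)
    assume "\<not> ?seg"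
    then obtain z where z: "\<And>i. i \<in> {1..n} \<Longrightarrow> dist (x i) y < dist (x i) z + dist z y"
      by (metis dist_triangle order_le_less)
    \<comment> \<open>An empty sum of weights would be 0, so the maximum below ranges over a
      nonempty set.\<close>
    have ne: "{1..n} \<noteq> {}"
      using assms(5) by force
    \<comment> \<open>A norming \<open>f\<close> in the unit ball satisfies
      \<open>f p - f y \<ge> dist (x i) y - dist (x i) p\<close> for each \<open>i\<close>;
      \<open>g\<close> is the largest of these lower bounds.\<close>
    define g where "g p = (MAX i\<in>{1..n}. dist (x i) y - dist (x i) p)" for p
    have g_ge: "dist (x i) y - dist (x i) p \<le> g p" if "i \<in> {1..n}" for i p
      unfolding g_def by (rule Max_ge) (use that in auto)
    have g_attained: "\<exists>i\<in>{1..n}. g p = dist (x i) y - dist (x i) p" for p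
    proof -
      have "g p \<in> (\<lambda>i. dist (x i) y - dist (x i) p) ` {1..n}"
        unfolding g_def by (rule Max_in) (use ne in auto)
      then show ?thesis by blast
    qed
    have g_lip: "g p - g q \<le> dist p q" for p q
    proof -
      obtain i where "i \<in> {1..n}" "g p = dist (x i) y - dist (x i) p"
        using g_attained by blast
      then show ?thesis
        using g_ge[of i q] dist_triangle[of "x i" q p] by linarith
    qed
    obtain G :: "'a lip0" where G: "norm G \<le> 1" "\<And>p. lip0_apply G p = g p - g base_point"
      using lip0_normalise[OF g_lip] by blast
    have gy: "g y = 0"
      using g_attained[of y] by auto
    have phi_G: "blinfun_apply \<phi> G = 1"
    proof (rule norming)
      fix i assume "i \<in> {1..n}"
      then show "lip0_apply G (x i) - lip0_apply G y = dist (x i) y"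
        \<comment> \<open>The index \<open>i\<close> itself gives
          \<open>g (x i) \<ge> dist (x i) y\<close>; slope at most one and \<open>g y = 0\<close>
          give the converse.\<close>
        using g_ge[of i "x i"] g_lip[of "x i" y] gy by (simp add: G)
    qed
    have "blinfun_apply (lip_delta z - lip_delta y) f0 = blinfun_apply (lip_delta z - lip_delta y) G"
      using phi_f0 phi_G norm_phi
      by (intro gateaux_point_norming_eq[OF gateaux lip_delta_diff_in_lipschitz_free f0(1) _ G(1)])
        simp_all
    then have "dist z y = g z"
      by (simp add: blinfun.diff_left lip_delta.rep_eq f0(2) G(2) gy)
    then show False
      \<comment> \<open>At an index attaining \<open>g z\<close>, the strict triangle inequality
        yields \<open>g z < dist z y\<close>.\<close>
      using g_attained[of z] z by fastforce
  qed
  moreover have "gateaux_point lipschitz_free \<phi>" if "frechet_point lipschitz_free \<phi>"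
    using that unfolding frechet_point_def by blast
  ultimately show ?thesis by blast
qed

end
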